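(* For any integers $n\ge g\ge1$, we have $\Delta\!\left(\frac{R(g,n)}{n}\right)\le\frac gn$.
   Context: Let $\lambda$ denote Lebesgue measure on $\mathbb{R}$. A set $C\subseteq\mathbb{R}$ is symmetric if there is a number $c$ such that, for all $x$, $c+x\in C$ if and only if $c-x\in C$. For a measurable set $A$ of reals put $D(A):=\sup\{\lambda(C): C\subseteq A,\ C\text{ measurable and symmetric}\}$, and for $0\le\varepsilon\le1$ define $\Delta(\varepsilon):=\inf\{D(A): A\subseteq[0,1)\text{ measurable},\ \lambda(A)=\varepsilon\}$. A set $S$ of integers is called a $B^\ast[g]$ set if for every integer $m$ there are at most $g$ ordered pairs $(s_1,s_2)\in S\times S$ with $s_1+s_2=m$. $R(g,n)$ denotes the largest cardinality of a $B^\ast[g]$ set contained in $\{1,2,\dots,n\}$. *)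

theory Defs
  imports "HOL-Analysis.Analysis"
begin

definition symmetric_set :: "real set \<Rightarrow> bool" where
  "symmetric_set C \<longleftrightarrow> (\<exists>c. \<forall>x. c + x \<in> C \<longleftrightarrow> c - x \<in> C)"

(* Values are in ennreal, where every supremum and infimum exists: the supremum
   below may be infinite when A has infinite measure. *)
definition max_sym :: "real set \<Rightarrow> ennreal" where
  "max_sym A = (SUP C \<in> {C. C \<subseteq> A \<and> C \<in> sets lebesgue \<and> symmetric_set C}. emeasure lebesgue C)"

(* Meaningful for 0 \<le> \<epsilon> \<le> 1 only. *)
definition Delta :: "real \<Rightarrow> ennreal" where
  "Delta \<epsilon> = (INF A \<in> {A. A \<subseteq> {0..<1} \<and> A \<in> sets lebesgue \<and> emeasure lebesgue A = ennreal \<epsilon>}. max_sym A)"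

(* The finiteness conjunct is needed because card is 0 on infinite sets. *)
definition Bstar :: "nat \<Rightarrow> int set \<Rightarrow> bool" where
  "Bstar g S \<longleftrightarrow> (\<forall>m. finite {(s1, s2) \<in> S \<times> S. s1 + s2 = m} \<and>
                      card {(s1, s2) \<in> S \<times> S. s1 + s2 = m} \<le> g)"

definition R :: "nat \<Rightarrow> nat \<Rightarrow> nat" where
  "R g n = Max {card S | S. S \<subseteq> {1..int n} \<and> Bstar g S}"

end

theory Submission
  imports Defs
begin

text \<open>
  Blow up a largest \<open>B\<^sup>*[g]\<close> set \<open>S \<subseteq> {1..n}\<close> to the union \<open>A\<close> of the cells \<open>[(s - 1)/n, s/n)\<close>,
  \<open>s \<in> S\<close>, which has measure \<open>card S / n\<close>. If \<open>C \<subseteq> A\<close> is symmetric about \<open>c\<close>, then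
  \<open>C \<subseteq> A \<inter> (2c - A)\<close>, so it suffices to bound the measure of the latter set by \<open>g/n\<close>.

  Translate all cells onto one of them. The measure of a subset of \<open>A\<close> is then \<open>1/n\<close>
  times the average, over \<open>t \<in> [0, 1)\<close>, of the number of \<open>s \<in> S\<close> for which the point
  \<open>(s - 1 + t)/n\<close>, the one with offset \<open>t\<close> in cell \<open>s\<close>, lies in the subset
  (\<open>emeasure_fold_cells\<close>). For fixed \<open>t\<close>, reflecting the point with
  offset \<open>t\<close> in cell \<open>s\<close> about \<open>c\<close> leads into a cell \<open>s'\<close> for which \<open>s + s'\<close> is determined by \<open>t\<close>
  and \<open>c\<close> alone. Each cell counted thus yields a different representation of one integer as a sum
  of two elements of \<open>S\<close>, and there are at most \<open>g\<close> of these (\<open>card_reflected_cells_le\<close>).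
\<close>

text \<open>Defining the blow-up through the floor makes it Borel and reduces its geometry to rules about
  the floor of a sum.\<close>
definition cells :: "nat \<Rightarrow> int set \<Rightarrow> real set" where
  "cells n S = {x. \<lfloor>real n * x\<rfloor> + 1 \<in> S}"

lemma cells_borel [measurable]: "cells n S \<in> sets borel"
proof -
  have "cells n S = (\<lambda>x. \<lfloor>real n * x\<rfloor>) -` {k. k + 1 \<in> S} \<inter> space borel"
    by (auto simp: cells_def)
  also have "\<dots> \<in> sets borel"
    by (rule measurable_sets[where A = "count_space UNIV"]) auto
  finally show ?thesis .
qed

lemma cells_subset_unit:
  assumes "0 < n" "S \<subseteq> {1..int n}"
  shows "cells n S \<subseteq> {0..<1}"
proof
  fix x assume "x \<in> cells n S"
  with assms(2) have "0 \<le> \<lfloor>real n * x\<rfloor>" "\<lfloor>real n * x\<rfloor> + 1 \<le> int n"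
    by (auto simp: cells_def)
  then have "0 \<le> real n * x" "real n * x < real n"
    by linarith+
  with assms(1) show "x \<in> {0..<1}"
    using assms(1) mult_less_cancel_left_pos[of "real n" x 1] by (auto simp: zero_le_mult_iff)
qed

lemma floor_cell_point:
  fixes s :: int and t :: real
  assumes "0 < n" "t \<in> {0..<1}"
  shows "\<lfloor>real n * ((of_int s - 1 + t) / n)\<rfloor> = s - 1"
  using assms by (auto simp: floor_eq_iff)

text \<open>The substitution \<open>x = (s - 1 + t) / n\<close> brings the part of \<open>B\<close> in each cell \<open>s\<close> to the common
  domain \<open>[0, 1)\<close>, where the indicators of the parts add up to the counting function.\<close>
lemma emeasure_fold_cells:
  assumes n: "0 < n" and S: "finite S"
    and B: "B \<in> sets borel" "B \<subseteq> cells n S"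
  shows "emeasure lborel B =
    ennreal (1 / n) * (\<integral>\<^sup>+t. of_nat (card {s\<in>S. (of_int s - 1 + t) / n \<in> B}) * indicator {0..<1} t \<partial>lborel)"
proof -
  note [measurable] = B(1)
  let ?I = "\<lambda>s x. indicator {0..<1::real} (real n * x - (s - 1)) :: ennreal"
  have cell: "?I s x = (if \<lfloor>real n * x\<rfloor> + 1 = s then 1 else 0)" for s :: int and x :: real
    by (auto simp: indicator_def) linarith+
  have split: "indicator B x = (\<Sum>s\<in>S. indicator B x * ?I s x)" for x
  proof (cases "x \<in> B")
    case True
    then have "\<lfloor>real n * x\<rfloor> + 1 \<in> S"
      using B(2) by (auto simp: cells_def)
    then show ?thesis
      unfolding cell using S True by (simp add: sum.delta)
  qed simp
  have shift: "(\<integral>\<^sup>+x. indicator B x * ?I s x \<partial>lborel) =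
      ennreal (1 / n) * (\<integral>\<^sup>+t. indicator B ((of_int s - 1 + t) / n) * indicator {0..<1} t \<partial>lborel)"
    for s :: int
    using n by (subst nn_integral_real_affine[where c = "1 / n" and t = "(s - 1) / n"])
      (auto simp: field_simps)
  have count: "(\<Sum>s\<in>S. indicator B ((of_int s - 1 + t) / n) * indicator {0..<1} t :: ennreal) =
      of_nat (card {s\<in>S. (of_int s - 1 + t) / n \<in> B}) * indicator {0..<1} t" for t :: real
  proof -
    have "(\<Sum>s\<in>S. indicator B ((of_int s - 1 + t) / n) :: ennreal)
        = (\<Sum>s\<in>S. if (of_int s - 1 + t) / n \<in> B then 1 else 0)"
      by (intro sum.cong) auto
    also have "\<dots> = of_nat (card {s\<in>S. (of_int s - 1 + t) / n \<in> B})"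
      using S by (simp add: sum.If_cases Int_def)
    finally show ?thesis
      by (simp add: sum_distrib_right[symmetric])
  qed
  have "emeasure lborel B = (\<integral>\<^sup>+x. (\<Sum>s\<in>S. indicator B x * ?I s x) \<partial>lborel)"
    unfolding split[symmetric] by simp
  also have "\<dots> = (\<Sum>s\<in>S. \<integral>\<^sup>+x. indicator B x * ?I s x \<partial>lborel)"
    by (intro nn_integral_sum) measurable
  also have "\<dots> = ennreal (1 / n) *
      (\<Sum>s\<in>S. \<integral>\<^sup>+t. indicator B ((of_int s - 1 + t) / n) * indicator {0..<1} t \<partial>lborel)"
    unfolding shift by (rule sum_distrib_left[symmetric])
  also have "(\<Sum>s\<in>S. \<integral>\<^sup>+t. indicator B ((of_int s - 1 + t) / n) * indicator {0..<1} t \<partial>lborel) =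
      (\<integral>\<^sup>+t. (\<Sum>s\<in>S. indicator B ((of_int s - 1 + t) / n) * indicator {0..<1} t) \<partial>lborel)"
    by (intro nn_integral_sum[symmetric]) measurable
  finally show ?thesis
    unfolding count .
qed

lemma emeasure_cells:
  assumes "0 < n" "finite S"
  shows "emeasure lborel (cells n S) = ennreal (card S / n)"
proof -
  have "of_nat (card {s\<in>S. (of_int s - 1 + t) / n \<in> cells n S}) * indicator {0..<1} t =
      (of_nat (card S) * indicator {0..<1} t :: ennreal)" for t :: real
  proof (cases "t \<in> {0..<1}")
    case True
    have "(of_int s - 1 + t) / n \<in> cells n S" if "s \<in> S" for s
      using that unfolding cells_def mem_Collect_eq floor_cell_point[OF assms(1) True] by simp
    then have "{s\<in>S. (of_int s - 1 + t) / n \<in> cells n S} = S"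
      by blast
    then show ?thesis by simp
  qed simp
  then have "emeasure lborel (cells n S) = ennreal (1 / n) * of_nat (card S)"
    using emeasure_fold_cells[OF assms cells_borel order.refl]
    by (simp add: nn_integral_cmult)
  then show ?thesis
    by (simp add: ennreal_of_nat_eq_real_of_nat ennreal_mult[symmetric])
qed

text \<open>The cell containing the mirror image of the point with offset \<open>t\<close> in cell \<open>s\<close> has index
  \<open>m - s\<close>, where \<open>m = \<lfloor>2cn - t\<rfloor> + 2\<close> is the same for all \<open>s\<close>.\<close>
lemma card_reflected_cells_le:
  fixes t :: real
  assumes "Bstar g S" "0 < n" "t \<in> {0..<1}"
  shows "card {s\<in>S. (of_int s - 1 + t) / n \<in> cells n S \<inter> {x. 2 * c - x \<in> cells n S}} \<le> g"
    (is "card ?T \<le> g")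
proof -
  define m where "m = \<lfloor>2 * c * n - t\<rfloor> + 2"
  let ?P = "{(s1, s2) \<in> S \<times> S. s1 + s2 = m}"
  have P: "finite ?P" "card ?P \<le> g"
    using assms(1) by (auto simp: Bstar_def)
  have "m - s \<in> S" if "s \<in> ?T" for s
  proof -
    have "real n * (2 * c - (of_int s - 1 + t) / n) = (2 * c * n - t) - of_int (s - 1)"
      using assms(2) by (simp add: field_simps)
    then have "\<lfloor>real n * (2 * c - (of_int s - 1 + t) / n)\<rfloor> + 1 = m - s"
      unfolding m_def by linarith
    with that show ?thesis
      by (auto simp: cells_def)
  qed
  then have "(\<lambda>s. (s, m - s)) ` ?T \<subseteq> ?P"
    by auto
  then have "card ?T \<le> card ?P"
    using P(1) by (intro card_inj_on_le[where f = "\<lambda>s. (s, m - s)"]) (auto simp: inj_on_def)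
  with P(2) show ?thesis by simp
qed

lemma emeasure_cells_Int_reflection_le:
  assumes "Bstar g S" "0 < n" "finite S"
  shows "emeasure lborel (cells n S \<inter> {x. 2 * c - x \<in> cells n S}) \<le> ennreal (g / n)"
    (is "emeasure lborel ?B \<le> _")
proof -
  have "?B \<in> sets borel" by measurable
  then have "emeasure lborel ?B = ennreal (1 / n) *
      (\<integral>\<^sup>+t. of_nat (card {s\<in>S. (of_int s - 1 + t) / n \<in> ?B}) * indicator {0..<1} t \<partial>lborel)"
    by (intro emeasure_fold_cells assms) auto
  also have "\<dots> \<le> ennreal (1 / n) * (\<integral>\<^sup>+t. of_nat g * indicator {0..<1::real} t \<partial>lborel)"
  proof (intro mult_left_mono nn_integral_mono)
    fix t :: real
    show "of_nat (card {s\<in>S. (of_int s - 1 + t) / n \<in> ?B}) * indicator {0..<1} t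
        \<le> (of_nat g * indicator {0..<1} t :: ennreal)"
      using card_reflected_cells_le[OF assms(1,2), of t c]
      by (cases "t \<in> {0..<1}") auto
  qed simp
  also have "\<dots> = ennreal (g / n)"
    by (simp add: nn_integral_cmult ennreal_of_nat_eq_real_of_nat ennreal_mult[symmetric])
  finally show ?thesis .
qed

lemma max_sym_cells_le:
  assumes "Bstar g S" "0 < n" "finite S"
  shows "max_sym (cells n S) \<le> ennreal (g / n)"
  unfolding max_sym_def
proof (rule SUP_least, clarify)
  fix C assume C: "C \<subseteq> cells n S" "symmetric_set C"
  obtain c where c: "\<And>x. c + x \<in> C \<longleftrightarrow> c - x \<in> C"
    using C(2) by (auto simp: symmetric_set_def)
  let ?B = "cells n S \<inter> {x. 2 * c - x \<in> cells n S}"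
  have "2 * c - x \<in> C" if "x \<in> C" for x
    using c[of "x - c"] that by (simp add: algebra_simps)
  then have "C \<subseteq> ?B"
    using C(1) by auto
  moreover have B: "?B \<in> sets borel" by measurable
  ultimately have "emeasure lebesgue C \<le> emeasure lebesgue ?B"
    by (intro emeasure_mono) auto
  also have "\<dots> = emeasure lborel ?B"
    using B by simp
  also have "\<dots> \<le> ennreal (g / n)"
    by (rule emeasure_cells_Int_reflection_le[OF assms])
  finally show "emeasure lebesgue C \<le> ennreal (g / n)" .
qed

lemma R_attained:
  obtains S where "S \<subseteq> {1..int n}" "Bstar g S" "card S = R g n"
proof -
  let ?K = "{card S | S. S \<subseteq> {1..int n} \<and> Bstar g S}"
  have "?K \<subseteq> card ` Pow {1..int n}" by auto
  then have "finite ?K" by (rule finite_subset) simp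
  moreover have "Bstar g {}" by (simp add: Bstar_def)
  then have "?K \<noteq> {}" by blast
  ultimately have "R g n \<in> ?K"
    unfolding R_def by (rule Max_in)
  then show ?thesis using that by auto
qed

theorem proposition5p1:
  fixes g n :: nat
  assumes "1 \<le> g" and "g \<le> n"
  shows "Delta (real (R g n) / real n) \<le> ennreal (real g / real n)"
proof -
  have n: "0 < n" using assms by simp
  obtain S where S: "S \<subseteq> {1..int n}" "Bstar g S" "card S = R g n"
    by (rule R_attained)
  have fin: "finite S"
    using S(1) by (rule finite_subset) simp
  have "emeasure lebesgue (cells n S) = ennreal (real (R g n) / real n)"
    using emeasure_cells[OF n fin] S(3) by simp
  then have "Delta (real (R g n) / real n) \<le> max_sym (cells n S)"
    unfolding Delta_def using cells_subset_unit[OF n S(1)]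
    by (intro INF_lower) auto
  also have "\<dots> \<le> ennreal (real g / real n)"
    by (rule max_sym_cells_le[OF S(2) n fin])
  finally show ?thesis .
qed

end
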